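(* Let $M$ be an $n$-dimensional space form $M(c)$ of constant sectional curvature $c$, or an $n$-dimensional hypersurface of Euclidean space $E^{n+1}$, with $n\ge 3$. Let $\alpha: I\to M$ be a non-degenerate curve with Frenet frame $\{v_1,\dots,v_n\}$ and harmonic curvatures $\{H_1,\dots,H_{n-2}\}$. If $\alpha$ is an LC helix with axis $X$, then $$\langle v_{i+2},X\rangle = H_i\,\langle v_1,X\rangle ,\qquad 1<i\le n-2 .$$
   Context: Let $\nabla$ be the Levi-Civita connection of $M$ and $\langle\cdot,\cdot\rangle$ its metric; $I\subset\mathbb{R}$ is an open interval. A non-degenerate ($n$-th order regular) curve $\alpha:I\to M$ is a smooth curve with an orthonormal Frenet frame $\{v_1,\dots,v_n\}$ of vector fields along $\alpha$ tangent to $M$, where $v_1$ is the unit tangent, and with nowhere vanishing curvatures $k_1,\dots,k_{n-1}$ (also written $\kappa_i$), such that $\nabla_{v_1}v_1=k_1v_2$, $\nabla_{v_1}v_i=-k_{i-1}v_{i-1}+k_iv_{i+1}$ for $1<i<n$, and $\nabla_{v_1}v_n=-k_{n-1}v_{n-1}$. For a function $f$ along $\alpha$, $v_1[f]$ denotes the derivative of $f$ with respect to arc length. Harmonic curvatures: $H_0=0$, $H_1=\dfrac{k_1}{k_2}$, and $H_i=\dfrac{1}{k_{i+1}}\left(v_1[H_{i-1}]+k_iH_{i-2}\right)$ for $1<i\le n-2$. A vector field $X$ along $\alpha$ tangent to $M$ is LC parallel (parallel in the sense of Levi-Civita) if $\nabla_{v_1}X=0$. The curve $\alpha$ is an LC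 helix if there is a unit LC parallel vector field $X$ along $\alpha$ such that $\langle v_1,X\rangle=\cos\varphi$ is constant along $\alpha$; such an $X$ is called an axis of the LC helix. *)

theory Defs
  imports "HOL-Analysis.Analysis"
begin

section \<open>Smooth maps between Euclidean spaces\<close>

text \<open>Only used for open sets \<open>S\<close>; \<open>k\<close> counts the continuous derivatives.\<close>

primrec times_differentiable_on ::
  "nat \<Rightarrow> 'a::real_normed_vector set \<Rightarrow> ('a \<Rightarrow> 'b::real_normed_vector) \<Rightarrow> bool" where
  "times_differentiable_on 0 S f \<longleftrightarrow> continuous_on S f"
| "times_differentiable_on (Suc k) S f \<longleftrightarrow>
     (\<forall>x\<in>S. f differentiable (at x)) \<and>
     (\<forall>v. times_differentiable_on k S (\<lambda>x. frechet_derivative f (at x) v))"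

definition smooth_on :: "'a::real_normed_vector set \<Rightarrow> ('a \<Rightarrow> 'b::real_normed_vector) \<Rightarrow> bool" where
  "smooth_on S f \<longleftrightarrow> (\<forall>k. times_differentiable_on k S f)"

definition partial_deriv :: "'n::finite \<Rightarrow> (real^'n \<Rightarrow> real) \<Rightarrow> real^'n \<Rightarrow> real" where
  "partial_deriv i f x = frechet_derivative f (at x) (axis i 1)"


section \<open>Riemannian manifolds\<close>

text \<open>A chart is a pair of its domain and its coordinate map (whose values off the domain are
  irrelevant). The metric is given by its coefficient matrices in the charts of the atlas, as
  functions of the coordinates. The dimension is \<open>CARD('n)\<close>.\<close>

type_synonym ('m, 'n) chart = "'m set \<times> ('m \<Rightarrow> real^'n)"

record ('m, 'n) manifold =
  mtop :: "'m topology"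
  atlas :: "('m, 'n::finite) chart set"
  mcoeff :: "('m, 'n) chart \<Rightarrow> real^'n \<Rightarrow> real^'n^'n"

definition charts_at :: "('m, 'n::finite) manifold \<Rightarrow> 'm \<Rightarrow> ('m, 'n) chart set" where
  "charts_at M p = {c \<in> atlas M. p \<in> fst c}"

definition chart_inv :: "('m, 'n) chart \<Rightarrow> real^'n \<Rightarrow> 'm" where
  "chart_inv c = inv_into (fst c) (snd c)"

definition transition :: "('m, 'n) chart \<Rightarrow> ('m, 'n) chart \<Rightarrow> real^'n \<Rightarrow> real^'n" where
  "transition c d = snd d \<circ> chart_inv c"

definition smooth_manifold :: "('m, 'n::finite) manifold \<Rightarrow> bool" where
  "smooth_manifold M \<longleftrightarrow>
     Hausdorff_space (mtop M) \<and> second_countable (mtop M) \<and>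
     topspace (mtop M) = (\<Union>c\<in>atlas M. fst c) \<and>
     (\<forall>c\<in>atlas M. openin (mtop M) (fst c) \<and> open (snd c ` fst c) \<and>
        homeomorphic_map (subtopology (mtop M) (fst c)) (top_of_set (snd c ` fst c)) (snd c)) \<and>
     (\<forall>c\<in>atlas M. \<forall>d\<in>atlas M. smooth_on (snd c ` (fst c \<inter> fst d)) (transition c d))"

definition metric_in :: "('m, 'n::finite) manifold \<Rightarrow> ('m, 'n) chart \<Rightarrow> real^'n \<Rightarrow>
    real^'n \<Rightarrow> real^'n \<Rightarrow> real" where
  "metric_in M c x u v = u \<bullet> (mcoeff M c x *v v)"

definition riemannian_manifold :: "('m, 'n::finite) manifold \<Rightarrow> bool" where
  "riemannian_manifold M \<longleftrightarrow> smooth_manifold M \<and>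
     (\<forall>c\<in>atlas M. smooth_on (snd c ` fst c) (mcoeff M c)) \<and>
     (\<forall>c\<in>atlas M. \<forall>x\<in>snd c ` fst c.
        (\<forall>u v. metric_in M c x u v = metric_in M c x v u) \<and>
        (\<forall>u. u \<noteq> 0 \<longrightarrow> metric_in M c x u u > 0)) \<and>
     (\<forall>c\<in>atlas M. \<forall>d\<in>atlas M. \<forall>x\<in>snd c ` (fst c \<inter> fst d). \<forall>u v.
        metric_in M c x u v =
        metric_in M d (transition c d x)
          (frechet_derivative (transition c d) (at x) u)
          (frechet_derivative (transition c d) (at x) v))"

text \<open>A tangent vector at \<open>p\<close> is the family of its components in all charts around \<open>p\<close>, obeying the
  contravariant transformation law. Components in all other charts are set to \<open>0\<close>, so that
  equality of tangent vectors at \<open>p\<close> is equality of functions.\<close>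

type_synonym ('m, 'n) tangent = "('m, 'n) chart \<Rightarrow> real^'n"

definition tangent_space :: "('m, 'n::finite) manifold \<Rightarrow> 'm \<Rightarrow> ('m, 'n) tangent set" where
  "tangent_space M p = {\<xi>.
     (\<forall>c. c \<notin> charts_at M p \<longrightarrow> \<xi> c = 0) \<and>
     (\<forall>c\<in>charts_at M p. \<forall>d\<in>charts_at M p.
        \<xi> d = frechet_derivative (transition c d) (at (snd c p)) (\<xi> c))}"

text \<open>The common value of the coordinate expressions of the metric in all charts around \<open>p\<close>; see
  \<open>riem_inner_eq\<close> below.\<close>

definition riem_inner :: "('m, 'n::finite) manifold \<Rightarrow> 'm \<Rightarrow> ('m, 'n) tangent \<Rightarrow>
    ('m, 'n) tangent \<Rightarrow> real" where
  "riem_inner M p \<xi> \<eta> =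
     (THE r. \<forall>c\<in>charts_at M p. r = metric_in M c (snd c p) (\<xi> c) (\<eta> c))"

lemma riem_inner_eq:
  assumes M: "riemannian_manifold M" and c: "c \<in> charts_at M p"
    and \<xi>: "\<xi> \<in> tangent_space M p" and \<eta>: "\<eta> \<in> tangent_space M p"
  shows "riem_inner M p \<xi> \<eta> = metric_in M c (snd c p) (\<xi> c) (\<eta> c)"
proof -
  have inv: "transition c d (snd c p) = snd d p" for d
  proof -
    have "inj_on (snd c) (fst c)"
    proof -
      have "homeomorphic_map (subtopology (mtop M) (fst c)) (top_of_set (snd c ` fst c)) (snd c)"
           "openin (mtop M) (fst c)"
        using M c unfolding riemannian_manifold_def smooth_manifold_def charts_at_def by blast+
      then have "inj_on (snd c) (topspace (subtopology (mtop M) (fst c)))"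
        by (intro homeomorphic_imp_injective_map)
      moreover have "topspace (subtopology (mtop M) (fst c)) = fst c"
        using \<open>openin (mtop M) (fst c)\<close> by (simp add: openin_subset Int_absorb1)
      ultimately show ?thesis by simp
    qed
    then show ?thesis
      using c by (simp add: transition_def chart_inv_def charts_at_def)
  qed
  have "metric_in M c (snd c p) (\<xi> c) (\<eta> c) = metric_in M d (snd d p) (\<xi> d) (\<eta> d)"
    if d: "d \<in> charts_at M p" for d
  proof -
    have cd: "c \<in> atlas M" "d \<in> atlas M" "snd c p \<in> snd c ` (fst c \<inter> fst d)"
      using c d by (auto simp: charts_at_def)
    have "\<xi> d = frechet_derivative (transition c d) (at (snd c p)) (\<xi> c)"
         "\<eta> d = frechet_derivative (transition c d) (at (snd c p)) (\<eta> c)"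
      using \<xi> \<eta> c d unfolding tangent_space_def by blast+
    moreover have "\<forall>u v. metric_in M c (snd c p) u v =
        metric_in M d (transition c d (snd c p))
          (frechet_derivative (transition c d) (at (snd c p)) u)
          (frechet_derivative (transition c d) (at (snd c p)) v)"
      using M cd unfolding riemannian_manifold_def by blast
    ultimately show ?thesis by (simp add: inv)
  qed
  then have "\<forall>d\<in>charts_at M p. metric_in M c (snd c p) (\<xi> c) (\<eta> c) = metric_in M d (snd d p) (\<xi> d) (\<eta> d)"
    by blast
  then show ?thesis
    unfolding riem_inner_def by (rule the_equality) (use c in blast)
qed


section \<open>Levi-Civita connection and curvature\<close>

text \<open>\<open>christoffel M c x l i j\<close> is the Christoffel symbol of the second kind, with upper index \<open>l\<close>.\<close>

definition christoffel :: "('m, 'n::finite) manifold \<Rightarrow> ('m, 'n) chart \<Rightarrow> real^'n \<Rightarrow>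
    'n \<Rightarrow> 'n \<Rightarrow> 'n \<Rightarrow> real" where
  "christoffel M c x l i j = (\<Sum>k\<in>UNIV. matrix_inv (mcoeff M c x) $ l $ k *
     (partial_deriv i (\<lambda>y. mcoeff M c y $ j $ k) x
      + partial_deriv j (\<lambda>y. mcoeff M c y $ i $ k) x
      - partial_deriv k (\<lambda>y. mcoeff M c y $ i $ j) x)) / 2"

text \<open>Components of \<open>R(u,v)w = \<nabla>\<^sub>u \<nabla>\<^sub>v w - \<nabla>\<^sub>v \<nabla>\<^sub>u w - \<nabla>\<^bsub>[u,v]\<^esub> w\<close>.\<close>

definition curvature_coeff :: "('m, 'n::finite) manifold \<Rightarrow> ('m, 'n) chart \<Rightarrow> real^'n \<Rightarrow>
    'n \<Rightarrow> 'n \<Rightarrow> 'n \<Rightarrow> 'n \<Rightarrow> real" where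
  "curvature_coeff M c x l i j k =
     partial_deriv i (\<lambda>y. christoffel M c y l j k) x
     - partial_deriv j (\<lambda>y. christoffel M c y l i k) x
     + (\<Sum>m\<in>UNIV. christoffel M c x l i m * christoffel M c x m j k
                 - christoffel M c x l j m * christoffel M c x m i k)"

definition curvature_in :: "('m, 'n::finite) manifold \<Rightarrow> ('m, 'n) chart \<Rightarrow> real^'n \<Rightarrow>
    real^'n \<Rightarrow> real^'n \<Rightarrow> real^'n \<Rightarrow> real^'n" where
  "curvature_in M c x u v w = (\<chi> l. \<Sum>i\<in>UNIV. \<Sum>j\<in>UNIV. \<Sum>k\<in>UNIV.
     curvature_coeff M c x l i j k * u $ i * v $ j * w $ k)"

definition sectional_curvature :: "('m, 'n::finite) manifold \<Rightarrow> ('m, 'n) chart \<Rightarrow> real^'n \<Rightarrow>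
    real^'n \<Rightarrow> real^'n \<Rightarrow> real" where
  "sectional_curvature M c x u v =
     metric_in M c x (curvature_in M c x u v v) u /
     (metric_in M c x u u * metric_in M c x v v - (metric_in M c x u v)\<^sup>2)"

definition constant_sectional_curvature :: "('m, 'n::finite) manifold \<Rightarrow> real \<Rightarrow> bool" where
  "constant_sectional_curvature M \<kappa> \<longleftrightarrow>
     (\<forall>c\<in>atlas M. \<forall>x\<in>snd c ` fst c. \<forall>u v.
        u \<noteq> v \<and> independent {u, v} \<longrightarrow> sectional_curvature M c x u v = \<kappa>)"


section \<open>Curves and vector fields along curves\<close>

definition smooth_curve :: "('m, 'n::finite) manifold \<Rightarrow> real set \<Rightarrow> (real \<Rightarrow> 'm) \<Rightarrow> bool" where
  "smooth_curve M I \<alpha> \<longleftrightarrow> continuous_map (top_of_set I) (mtop M) \<alpha> \<and>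
     (\<forall>c\<in>atlas M. smooth_on {t \<in> I. \<alpha> t \<in> fst c} (\<lambda>t. snd c (\<alpha> t)))"

definition velocity :: "('m, 'n::finite) manifold \<Rightarrow> (real \<Rightarrow> 'm) \<Rightarrow> real \<Rightarrow> ('m, 'n) tangent" where
  "velocity M \<alpha> t = (\<lambda>c. if c \<in> charts_at M (\<alpha> t)
     then vector_derivative (\<lambda>s. snd c (\<alpha> s)) (at t) else 0)"

definition speed :: "('m, 'n::finite) manifold \<Rightarrow> (real \<Rightarrow> 'm) \<Rightarrow> real \<Rightarrow> real" where
  "speed M \<alpha> t = sqrt (riem_inner M (\<alpha> t) (velocity M \<alpha> t) (velocity M \<alpha> t))"

definition vector_field_along :: "('m, 'n::finite) manifold \<Rightarrow> real set \<Rightarrow> (real \<Rightarrow> 'm) \<Rightarrow>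
    (real \<Rightarrow> ('m, 'n) tangent) \<Rightarrow> bool" where
  "vector_field_along M I \<alpha> X \<longleftrightarrow> (\<forall>t\<in>I. X t \<in> tangent_space M (\<alpha> t)) \<and>
     (\<forall>c\<in>atlas M. smooth_on {t \<in> I. \<alpha> t \<in> fst c} (\<lambda>t. X t c))"

text \<open>The Levi-Civita covariant derivative \<open>DX/dt\<close> along \<open>\<alpha>\<close>, for an arbitrary parameter \<open>t\<close>.\<close>

definition cov_deriv :: "('m, 'n::finite) manifold \<Rightarrow> (real \<Rightarrow> 'm) \<Rightarrow>
    (real \<Rightarrow> ('m, 'n) tangent) \<Rightarrow> real \<Rightarrow> ('m, 'n) tangent" where
  "cov_deriv M \<alpha> X t = (\<lambda>c. if c \<in> charts_at M (\<alpha> t)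
     then vector_derivative (\<lambda>s. X s c) (at t) +
       (\<chi> l. \<Sum>i\<in>UNIV. \<Sum>j\<in>UNIV.
          christoffel M c (snd c (\<alpha> t)) l i j * velocity M \<alpha> t c $ i * X t c $ j)
     else 0)"

text \<open>Since \<open>\<alpha>\<close> need not have unit speed, derivatives in the direction of the unit tangent are
  parameter derivatives divided by the speed.\<close>

definition nabla_v1 :: "('m, 'n::finite) manifold \<Rightarrow> (real \<Rightarrow> 'm) \<Rightarrow>
    (real \<Rightarrow> ('m, 'n) tangent) \<Rightarrow> real \<Rightarrow> ('m, 'n) tangent" where
  "nabla_v1 M \<alpha> X t = (\<lambda>c. cov_deriv M \<alpha> X t c /\<^sub>R speed M \<alpha> t)"

definition arclength_deriv :: "('m, 'n::finite) manifold \<Rightarrow> (real \<Rightarrow> 'm) \<Rightarrow>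
    (real \<Rightarrow> real) \<Rightarrow> real \<Rightarrow> real" where
  "arclength_deriv M \<alpha> f t = deriv f t / speed M \<alpha> t"


section \<open>Space forms and hypersurfaces\<close>

definition geodesically_complete :: "('m, 'n::finite) manifold \<Rightarrow> bool" where
  "geodesically_complete M \<longleftrightarrow>
     (\<forall>p\<in>topspace (mtop M). \<forall>\<xi>\<in>tangent_space M p.
        \<exists>\<gamma>. smooth_curve M UNIV \<gamma> \<and> \<gamma> 0 = p \<and> velocity M \<gamma> 0 = \<xi> \<and>
            (\<forall>t. cov_deriv M \<gamma> (velocity M \<gamma>) t = (\<lambda>c. 0)))"

definition space_form :: "('m, 'n::finite) manifold \<Rightarrow> real \<Rightarrow> bool" where
  "space_form M \<kappa> \<longleftrightarrow> riemannian_manifold M \<and> connected_space (mtop M) \<and>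
     geodesically_complete M \<and> constant_sectional_curvature M \<kappa>"

text \<open>The ambient Euclidean space of dimension \<open>CARD('n) + 1\<close> is \<open>real^'n \<times> real\<close>, whose inner
  product is the standard one. A hypersurface is an isometrically immersed (in particular, any
  embedded) manifold of codimension one, carrying the induced metric.\<close>

definition isometric_immersion :: "('m, 'n::finite) manifold \<Rightarrow>
    ('m \<Rightarrow> 'e::euclidean_space) \<Rightarrow> bool" where
  "isometric_immersion M f \<longleftrightarrow> (\<forall>c\<in>atlas M.
     smooth_on (snd c ` fst c) (f \<circ> chart_inv c) \<and>
     (\<forall>x\<in>snd c ` fst c. \<forall>u v.
        frechet_derivative (f \<circ> chart_inv c) (at x) u \<bullet> frechet_derivative (f \<circ> chart_inv c) (at x) v
        = metric_in M c x u v))"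

definition euclidean_hypersurface :: "('m, 'n::finite) manifold \<Rightarrow> bool" where
  "euclidean_hypersurface M \<longleftrightarrow> riemannian_manifold M \<and>
     (\<exists>f :: 'm \<Rightarrow> (real^'n) \<times> real. isometric_immersion M f)"


section \<open>Frenet curves, harmonic curvatures and LC helices\<close>

text \<open>The Frenet frame is \<open>v 1, \<dots>, v n\<close> and the curvatures are \<open>k 1, \<dots>, k (n - 1)\<close>; values of \<open>v\<close>
  and \<open>k\<close> at other indices are irrelevant.\<close>

definition nondegenerate_curve :: "('m, 'n::finite) manifold \<Rightarrow> real set \<Rightarrow> (real \<Rightarrow> 'm) \<Rightarrow>
    (nat \<Rightarrow> real \<Rightarrow> ('m, 'n) tangent) \<Rightarrow> (nat \<Rightarrow> real \<Rightarrow> real) \<Rightarrow> bool" where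
  "nondegenerate_curve M I \<alpha> v k \<longleftrightarrow> smooth_curve M I \<alpha> \<and>
     (\<forall>i\<in>{1..CARD('n)}. vector_field_along M I \<alpha> (v i)) \<and>
     (\<forall>t\<in>I. speed M \<alpha> t > 0 \<and> v 1 t = (\<lambda>c. velocity M \<alpha> t c /\<^sub>R speed M \<alpha> t)) \<and>
     (\<forall>t\<in>I. \<forall>i\<in>{1..CARD('n)}. \<forall>j\<in>{1..CARD('n)}.
        riem_inner M (\<alpha> t) (v i t) (v j t) = (if i = j then 1 else 0)) \<and>
     (\<forall>t\<in>I. \<forall>i\<in>{1..CARD('n) - 1}. k i t \<noteq> 0) \<and>
     (\<forall>t\<in>I. nabla_v1 M \<alpha> (v 1) t = (\<lambda>c. k 1 t *\<^sub>R v 2 t c)) \<and>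
     (\<forall>t\<in>I. \<forall>i. 1 < i \<and> i < CARD('n) \<longrightarrow>
        nabla_v1 M \<alpha> (v i) t = (\<lambda>c. - k (i - 1) t *\<^sub>R v (i - 1) t c + k i t *\<^sub>R v (i + 1) t c)) \<and>
     (\<forall>t\<in>I. nabla_v1 M \<alpha> (v CARD('n)) t =
        (\<lambda>c. - k (CARD('n) - 1) t *\<^sub>R v (CARD('n) - 1) t c))"

fun harmonic_curvature :: "('m, 'n::finite) manifold \<Rightarrow> (real \<Rightarrow> 'm) \<Rightarrow> (nat \<Rightarrow> real \<Rightarrow> real) \<Rightarrow>
    nat \<Rightarrow> real \<Rightarrow> real" where
  "harmonic_curvature M \<alpha> k 0 = (\<lambda>t. 0)"
| "harmonic_curvature M \<alpha> k (Suc 0) = (\<lambda>t. k 1 t / k 2 t)"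
| "harmonic_curvature M \<alpha> k (Suc (Suc j)) = (\<lambda>t. 1 / k (j + 3) t *
     (arclength_deriv M \<alpha> (harmonic_curvature M \<alpha> k (Suc j)) t
      + k (j + 2) t * harmonic_curvature M \<alpha> k j t))"

definition LC_parallel :: "('m, 'n::finite) manifold \<Rightarrow> real set \<Rightarrow> (real \<Rightarrow> 'm) \<Rightarrow>
    (real \<Rightarrow> ('m, 'n) tangent) \<Rightarrow> bool" where
  "LC_parallel M I \<alpha> X \<longleftrightarrow> vector_field_along M I \<alpha> X \<and>
     (\<forall>t\<in>I. nabla_v1 M \<alpha> X t = (\<lambda>c. 0))"

definition LC_helix_with_axis :: "('m, 'n::finite) manifold \<Rightarrow> real set \<Rightarrow> (real \<Rightarrow> 'm) \<Rightarrow>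
    (nat \<Rightarrow> real \<Rightarrow> ('m, 'n) tangent) \<Rightarrow> (real \<Rightarrow> ('m, 'n) tangent) \<Rightarrow> bool" where
  "LC_helix_with_axis M I \<alpha> v X \<longleftrightarrow> LC_parallel M I \<alpha> X \<and>
     (\<forall>t\<in>I. riem_inner M (\<alpha> t) (X t) (X t) = 1) \<and>
     (\<exists>\<phi>. \<forall>t\<in>I. riem_inner M (\<alpha> t) (v 1 t) (X t) = cos \<phi>)"

end

theory Submission
  imports Defs
begin

text \<open>
  Write \<open>f i = \<langle>v i, X\<rangle>\<close> and let primes denote arc length derivatives. The Levi-Civita connection is
  compatible with the metric, so for a parallel field \<open>X\<close> the derivative of \<open>f i\<close> is
  \<open>\<langle>\<nabla> (v i), X\<rangle>\<close>, and the Frenet equations turn into the scalar system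
  \<open>f 1' = k 1 * f 2\<close>, \<open>f i' = - k (i - 1) * f (i - 1) + k i * f (i + 1)\<close>.
  Since \<open>f 1\<close> is a constant \<open>cos \<phi>\<close> and the curvatures do not vanish, the system can be solved
  successively for \<open>f 2, f 3, \<dots>\<close>: first \<open>f 2 = 0\<close>, then \<open>f 3 = (k 1 / k 2) * cos \<phi>\<close>, and each
  later equation is the recursion of the harmonic curvatures multiplied by \<open>cos \<phi>\<close>.

  The connection is given by Christoffel symbols, so metric compatibility has to be derived in
  coordinates. Lowering the upper index of the Christoffel symbols cancels the inverse matrix of
  the metric (\<open>lowered_christoffel\<close>); the three partial derivatives left over then combine, by
  the symmetry of the metric, to the directional derivative of the metric
  (\<open>christoffel_metric_compatible\<close>). The product rule for inner products of fields along a curve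
  (\<open>riem_inner_has_derivative\<close>) follows, because near any parameter the curve stays in one chart.
\<close>

section \<open>Derivatives in coordinates\<close>

lemma smooth_on_imp_differentiable:
  assumes "smooth_on S f" "x \<in> S"
  shows "f differentiable (at x)"
proof -
  have "times_differentiable_on (Suc 0) S f" using assms(1) unfolding smooth_on_def by blast
  then show ?thesis using assms(2) by simp
qed

lemma partial_deriv_component:
  assumes "(g has_derivative G) (at x)"
  shows "partial_deriv i (\<lambda>y. g y $ j $ m) x = G (axis i 1) $ j $ m"
proof -
  have "((\<lambda>y. g y $ j $ m) has_derivative (\<lambda>h. G h $ j $ m)) (at x)"
    using assms by (intro bounded_linear.has_derivative[OF bounded_linear_vec_nth])
  then show ?thesis
    unfolding partial_deriv_def by (metis frechet_derivative_at)
qed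

lemma directional_deriv_eq_sum_partial_deriv:
  assumes G: "(g has_derivative G) (at x)"
  shows "G a $ j $ m = (\<Sum>i\<in>UNIV. a $ i * partial_deriv i (\<lambda>y. g y $ j $ m) x)"
proof -
  interpret linear G using G by (rule has_derivative_linear)
  have "G a = G (\<Sum>i\<in>UNIV. a $ i *\<^sub>R axis i 1)"
    using basis_expansion[of a] by (simp add: scalar_mult_eq_scaleR)
  also have "\<dots> = (\<Sum>i\<in>UNIV. a $ i *\<^sub>R G (axis i 1))"
    by (simp add: sum scaleR)
  finally show ?thesis
    by (simp add: partial_deriv_component[OF G])
qed

lemma partial_deriv_local_cong:
  assumes "open S" "x \<in> S" "\<And>y. y \<in> S \<Longrightarrow> f y = g y"
  shows "partial_deriv i f x = partial_deriv i g x"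
proof -
  have "(f has_derivative F) (at x) \<longleftrightarrow> (g has_derivative F) (at x)" for F
    using has_derivative_transform_within_open[of f F x UNIV S g]
      has_derivative_transform_within_open[of g F x UNIV S f] assms by auto
  then show ?thesis unfolding partial_deriv_def frechet_derivative_def by simp
qed

section \<open>Compatibility of the Christoffel symbols with the metric\<close>

text \<open>A matrix with positive quadratic form has trivial kernel; this makes the inverse matrix in the
  Christoffel symbols a true inverse.\<close>

lemma positive_definite_right_inverse:
  fixes A :: "real^'n::finite^'n"
  assumes "\<And>u. u \<noteq> 0 \<Longrightarrow> u \<bullet> (A *v u) > 0"
  shows "A ** matrix_inv A = mat 1"
proof -
  have "\<forall>u. A *v u = 0 \<longrightarrow> u = 0"
    using assms by (metis inner_zero_right less_irrefl)
  then have "invertible A"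
    by (simp add: invertible_left_inverse matrix_left_invertible_ker)
  then show ?thesis unfolding invertible_def matrix_inv_def by (rule someI2_ex) blast
qed

lemma metric_in_sum:
  "metric_in M c x u w = (\<Sum>j\<in>UNIV. \<Sum>m\<in>UNIV. u $ j * mcoeff M c x $ j $ m * w $ m)"
  by (simp add: metric_in_def inner_vec_def matrix_vector_mult_def sum_distrib_left mult.assoc)

lemma metric_coeff_symmetric:
  assumes "riemannian_manifold M" "c \<in> atlas M" "x \<in> snd c ` fst c"
  shows "mcoeff M c x $ j $ m = mcoeff M c x $ m $ j"
proof -
  have entry: "metric_in M c x (axis j 1) (axis m 1) = mcoeff M c x $ j $ m" for j m
    by (simp add: metric_in_def matrix_vector_mul_component inner_axis' inner_axis)
  have "metric_in M c x (axis j 1) (axis m 1) = metric_in M c x (axis m 1) (axis j 1)"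
    using assms unfolding riemannian_manifold_def by blast
  then show ?thesis by (simp add: entry)
qed

lemma chart_image_open:
  assumes "riemannian_manifold M" "c \<in> atlas M"
  shows "open (snd c ` fst c)"
  using assms unfolding riemannian_manifold_def smooth_manifold_def by blast

lemma partial_deriv_metric_symmetric:
  assumes "riemannian_manifold M" "c \<in> atlas M" "x \<in> snd c ` fst c"
  shows "partial_deriv i (\<lambda>y. mcoeff M c y $ j $ m) x =
    partial_deriv i (\<lambda>y. mcoeff M c y $ m $ j) x"
  using assms
  by (intro partial_deriv_local_cong[OF chart_image_open[OF assms(1,2)]] metric_coeff_symmetric)

text \<open>The Christoffel symbols of the first kind: multiplying by the metric cancels its inverse.\<close>

lemma lowered_christoffel:
  assumes M: "riemannian_manifold M" and c: "c \<in> atlas M" and x: "x \<in> snd c ` fst c"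
  shows "(\<Sum>l\<in>UNIV. mcoeff M c x $ m $ l * christoffel M c x l i j) =
    (partial_deriv i (\<lambda>y. mcoeff M c y $ j $ m) x
     + partial_deriv j (\<lambda>y. mcoeff M c y $ i $ m) x
     - partial_deriv m (\<lambda>y. mcoeff M c y $ i $ j) x) / 2"
proof -
  define A where "A = mcoeff M c x"
  define T where "T p = (partial_deriv i (\<lambda>y. mcoeff M c y $ j $ p) x
     + partial_deriv j (\<lambda>y. mcoeff M c y $ i $ p) x
     - partial_deriv p (\<lambda>y. mcoeff M c y $ i $ j) x)" for p
  have "A ** matrix_inv A = mat 1"
    using M c x unfolding riemannian_manifold_def metric_in_def A_def
    by (intro positive_definite_right_inverse) blast
  then have inv: "(\<Sum>l\<in>UNIV. A $ m $ l * matrix_inv A $ l $ p) = (if m = p then 1 else 0)" for p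
    by (simp add: matrix_matrix_mult_def mat_def vec_eq_iff)
  have "(\<Sum>l\<in>UNIV. A $ m $ l * christoffel M c x l i j)
      = (\<Sum>l\<in>UNIV. \<Sum>p\<in>UNIV. A $ m $ l * matrix_inv A $ l $ p * T p) / 2"
    by (simp add: christoffel_def A_def T_def sum_distrib_left sum_divide_distrib mult.assoc)
  also have "(\<Sum>l\<in>UNIV. \<Sum>p\<in>UNIV. A $ m $ l * matrix_inv A $ l $ p * T p)
      = (\<Sum>p\<in>UNIV. (\<Sum>l\<in>UNIV. A $ m $ l * matrix_inv A $ l $ p) * T p)"
    by (subst sum.swap) (simp add: sum_distrib_right)
  also have "\<dots> = T m" by (simp add: inv if_distrib[where f = "\<lambda>z. z * _"] cong: if_cong)
  finally show ?thesis by (simp add: A_def T_def)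
qed

text \<open>The zeroth order part of the covariant derivative of a field with value \<open>u\<close> along a curve
  with velocity \<open>a\<close>.\<close>

definition christoffel_term :: "('m, 'n::finite) manifold \<Rightarrow> ('m, 'n) chart \<Rightarrow> real^'n \<Rightarrow>
    real^'n \<Rightarrow> real^'n \<Rightarrow> real^'n" where
  "christoffel_term M c x a u = (\<chi> l. \<Sum>i\<in>UNIV. \<Sum>j\<in>UNIV.
     christoffel M c x l i j * a $ i * u $ j)"

lemma metric_christoffel_term:
  assumes M: "riemannian_manifold M" and c: "c \<in> atlas M" and x: "x \<in> snd c ` fst c"
  shows "metric_in M c x w (christoffel_term M c x a u) = (\<Sum>i\<in>UNIV. \<Sum>j\<in>UNIV. \<Sum>m\<in>UNIV.
    (partial_deriv i (\<lambda>y. mcoeff M c y $ j $ m) x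
     + partial_deriv j (\<lambda>y. mcoeff M c y $ i $ m) x
     - partial_deriv m (\<lambda>y. mcoeff M c y $ i $ j) x) / 2 * (a $ i * u $ j * w $ m))"
    (is "_ = ?R")
proof -
  let ?g = "mcoeff M c x"
  \<comment> \<open>The sum over \<open>l\<close> is moved innermost, where it lowers the index.\<close>
  have "metric_in M c x w (christoffel_term M c x a u) = (\<Sum>m\<in>UNIV. \<Sum>l\<in>UNIV. \<Sum>i\<in>UNIV. \<Sum>j\<in>UNIV.
      ?g $ m $ l * christoffel M c x l i j * (a $ i * u $ j * w $ m))"
    by (simp add: metric_in_sum christoffel_term_def sum_distrib_left mult_ac)
  also have "\<dots> = (\<Sum>m\<in>UNIV. \<Sum>i\<in>UNIV. \<Sum>l\<in>UNIV. \<Sum>j\<in>UNIV.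
      ?g $ m $ l * christoffel M c x l i j * (a $ i * u $ j * w $ m))"
    by (rule sum.cong[OF refl], rule sum.swap)
  also have "\<dots> = (\<Sum>i\<in>UNIV. \<Sum>m\<in>UNIV. \<Sum>l\<in>UNIV. \<Sum>j\<in>UNIV.
      ?g $ m $ l * christoffel M c x l i j * (a $ i * u $ j * w $ m))"
    by (rule sum.swap)
  also have "\<dots> = (\<Sum>i\<in>UNIV. \<Sum>m\<in>UNIV. \<Sum>j\<in>UNIV. \<Sum>l\<in>UNIV.
      ?g $ m $ l * christoffel M c x l i j * (a $ i * u $ j * w $ m))"
    by (rule sum.cong[OF refl], rule sum.cong[OF refl], rule sum.swap)
  also have "\<dots> = (\<Sum>i\<in>UNIV. \<Sum>j\<in>UNIV. \<Sum>m\<in>UNIV. \<Sum>l\<in>UNIV.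
      ?g $ m $ l * christoffel M c x l i j * (a $ i * u $ j * w $ m))"
    by (rule sum.cong[OF refl], rule sum.swap)
  also have "\<dots> = ?R"
    by (simp only: sum_distrib_right[symmetric] lowered_christoffel[OF M c x])
  finally show ?thesis .
qed

lemma metric_in_commute:
  assumes "riemannian_manifold M" "c \<in> atlas M" "x \<in> snd c ` fst c"
  shows "metric_in M c x u w = metric_in M c x w u"
  using assms unfolding riemannian_manifold_def by blast

text \<open>The equation \<open>\<nabla>g = 0\<close> in coordinates. When both terms on the right are expanded into partial
  derivatives of the metric coefficients, exchanging the roles of \<open>u\<close> and \<open>w\<close> flips the sign of
  two of the three partial derivatives, and only the derivative in the direction \<open>a\<close> survives.\<close>

lemma christoffel_metric_compatible:
  assumes M: "riemannian_manifold M" and c: "c \<in> atlas M" and x: "x \<in> snd c ` fst c"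
    and G: "(mcoeff M c has_derivative G) (at x)"
  shows "u \<bullet> (G a *v w) = metric_in M c x (christoffel_term M c x a u) w
    + metric_in M c x u (christoffel_term M c x a w)"
proof -
  define d where "d i j m = partial_deriv i (\<lambda>y. mcoeff M c y $ j $ m) x" for i j m
  have sym: "d i j m = d i m j" for i j m
    unfolding d_def by (rule partial_deriv_metric_symmetric[OF M c x])
  have eq: "(d i j m + d j i m - d m i j) / 2 * (a $ i * u $ j * w $ m)
      + (d i m j + d m i j - d j i m) / 2 * (a $ i * w $ m * u $ j)
      = d i j m * (a $ i * u $ j * w $ m)" for i j m
    using sym[of i m j] by (simp add: field_simps)
  have "metric_in M c x (christoffel_term M c x a u) w
      = (\<Sum>i\<in>UNIV. \<Sum>j\<in>UNIV. \<Sum>m\<in>UNIV. (d i j m + d j i m - d m i j) / 2 * (a $ i * u $ j * w $ m))"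
    using metric_christoffel_term[OF M c x, of w a u]
    by (simp add: metric_in_commute[OF M c x, of w] d_def)
  \<comment> \<open>The summation indices \<open>j\<close> and \<open>m\<close> are exchanged, so that \<open>j\<close> belongs to \<open>u\<close> in both sums.\<close>
  moreover have "metric_in M c x u (christoffel_term M c x a w)
      = (\<Sum>i\<in>UNIV. \<Sum>j\<in>UNIV. \<Sum>m\<in>UNIV. (d i m j + d m i j - d j i m) / 2 * (a $ i * w $ m * u $ j))"
    unfolding metric_christoffel_term[OF M c x, of u a w] d_def
    by (rule sum.cong[OF refl], rule sum.swap)
  ultimately have "metric_in M c x (christoffel_term M c x a u) w
    + metric_in M c x u (christoffel_term M c x a w)
    = (\<Sum>i\<in>UNIV. \<Sum>j\<in>UNIV. \<Sum>m\<in>UNIV. d i j m * (a $ i * u $ j * w $ m))"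
    by (simp only: sum.distrib[symmetric] eq)
  also have "\<dots> = (\<Sum>j\<in>UNIV. \<Sum>m\<in>UNIV. \<Sum>i\<in>UNIV. d i j m * (a $ i * u $ j * w $ m))"
    by (subst sum.swap, rule sum.cong[OF refl], rule sum.swap)
  also have "\<dots> = (\<Sum>j\<in>UNIV. \<Sum>m\<in>UNIV. u $ j * G a $ j $ m * w $ m)"
    by (simp add: directional_deriv_eq_sum_partial_deriv[OF G] d_def sum_distrib_left
        sum_distrib_right mult_ac)
  also have "\<dots> = u \<bullet> (G a *v w)"
    by (simp add: inner_vec_def matrix_vector_mult_def sum_distrib_left mult.assoc)
  finally show ?thesis by simp
qed

lemma metric_in_bilinear:
  "metric_in M c x (u + u') w = metric_in M c x u w + metric_in M c x u' w"
  "metric_in M c x (r *\<^sub>R u) w = r * metric_in M c x u w"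
  "metric_in M c x u (w + w') = metric_in M c x u w + metric_in M c x u w'"
  "metric_in M c x u (r *\<^sub>R w) = r * metric_in M c x u w"
  by (simp_all add: metric_in_def algebra_simps scaleR_matrix_vector_assoc[symmetric]
      matrix_vector_mult_scaleR)

section \<open>Derivatives of inner products along a curve\<close>

text \<open>The product rule gives three terms, one of which differentiates the metric along the curve;
  metric compatibility splits that term into the corrections that complete \<open>u'\<close> and \<open>w'\<close> to
  covariant derivatives.\<close>

lemma metric_in_has_derivative:
  assumes M: "riemannian_manifold M" and c: "c \<in> atlas M" and x: "x t \<in> snd c ` fst c"
    and dx: "(x has_vector_derivative a) (at t)"
    and du: "(u has_vector_derivative u') (at t)"
    and dw: "(w has_vector_derivative w') (at t)"
  shows "((\<lambda>s. metric_in M c (x s) (u s) (w s)) has_real_derivative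
     metric_in M c (x t) (u' + christoffel_term M c (x t) a (u t)) (w t)
     + metric_in M c (x t) (u t) (w' + christoffel_term M c (x t) a (w t))) (at t)"
proof -
  have "mcoeff M c differentiable (at (x t))"
    using M c x smooth_on_imp_differentiable unfolding riemannian_manifold_def by blast
  then obtain G where G: "(mcoeff M c has_derivative G) (at (x t))"
    unfolding differentiable_def by blast
  interpret G: linear G using G by (rule has_derivative_linear)
  have dg: "((\<lambda>s. mcoeff M c (x s)) has_vector_derivative G a) (at t)"
    using vector_derivative_diff_chain_within[OF dx has_derivative_at_withinI[OF G]] by (simp add: o_def)
  have comp: "((\<lambda>s. f s $ i) has_real_derivative f' $ i) (at t)"
    if "(f has_vector_derivative f') (at t)" for f :: "real \<Rightarrow> real^'b" and f' i
    using bounded_linear.has_vector_derivative[OF bounded_linear_vec_nth that]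
    by (simp add: has_real_derivative_iff_has_vector_derivative)
  have comp2: "((\<lambda>s. mcoeff M c (x s) $ i $ j) has_real_derivative G a $ i $ j) (at t)" for i j
    using comp[OF bounded_linear.has_vector_derivative[OF bounded_linear_vec_nth dg]] .
  have "((\<lambda>s. metric_in M c (x s) (u s) (w s)) has_real_derivative
      (\<Sum>j\<in>UNIV. \<Sum>m\<in>UNIV. u' $ j * mcoeff M c (x t) $ j $ m * w t $ m
        + u t $ j * G a $ j $ m * w t $ m + u t $ j * mcoeff M c (x t) $ j $ m * w' $ m)) (at t)"
    unfolding metric_in_sum
    by (rule DERIV_sum, rule DERIV_sum)
      (auto intro!: derivative_eq_intros comp[OF du] comp[OF dw] comp2 simp: algebra_simps)
  moreover have "(\<Sum>j\<in>UNIV. \<Sum>m\<in>UNIV. u' $ j * mcoeff M c (x t) $ j $ m * w t $ m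
        + u t $ j * G a $ j $ m * w t $ m + u t $ j * mcoeff M c (x t) $ j $ m * w' $ m)
     = metric_in M c (x t) u' (w t) + u t \<bullet> (G a *v w t) + metric_in M c (x t) (u t) w'"
    by (simp add: metric_in_sum sum.distrib inner_vec_def matrix_vector_mult_def
        sum_distrib_left mult.assoc)
  ultimately show ?thesis
    by (simp add: christoffel_metric_compatible[OF M c x G] metric_in_bilinear add_ac)
qed

text \<open>The preceding product rule transfers from a chart to the curve because \<open>\<alpha>\<close> is continuous: it
  remains in the domain of the chart \<open>c\<close> for all parameters near \<open>t\<close>.\<close>

lemma riem_inner_has_derivative:
  assumes M: "riemannian_manifold M" and I: "open I" and \<alpha>: "smooth_curve M I \<alpha>"
    and Y: "vector_field_along M I \<alpha> Y" and Z: "vector_field_along M I \<alpha> Z"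
    and t: "t \<in> I" and c: "c \<in> charts_at M (\<alpha> t)"
  shows "((\<lambda>s. riem_inner M (\<alpha> s) (Y s) (Z s)) has_real_derivative
     metric_in M c (snd c (\<alpha> t)) (cov_deriv M \<alpha> Y t c) (Z t c)
     + metric_in M c (snd c (\<alpha> t)) (Y t c) (cov_deriv M \<alpha> Z t c)) (at t)"
proof -
  have cA: "c \<in> atlas M" and tc: "\<alpha> t \<in> fst c" using c by (auto simp: charts_at_def)
  define S where "S = {t \<in> I. \<alpha> t \<in> fst c}"
  have tS: "t \<in> S" using t tc by (simp add: S_def)
  have "continuous_map (top_of_set I) (mtop M) \<alpha>" "openin (mtop M) (fst c)"
    using \<alpha> M cA unfolding smooth_curve_def riemannian_manifold_def smooth_manifold_def by blast+
  then have "openin (top_of_set I) {s \<in> topspace (top_of_set I). \<alpha> s \<in> fst c}"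
    by (rule openin_continuous_map_preimage)
  then have openS: "open S" using I by (simp add: S_def openin_open_eq)
  have deriv: "(f has_vector_derivative vector_derivative f (at t)) (at t)"
    if "smooth_on S f" for f :: "real \<Rightarrow> real^'b"
    using smooth_on_imp_differentiable[OF that tS] by (simp add: vector_derivative_works)
  have sm: "smooth_on S (\<lambda>s. snd c (\<alpha> s))" "smooth_on S (\<lambda>s. Y s c)" "smooth_on S (\<lambda>s. Z s c)"
    using \<alpha> Y Z cA unfolding smooth_curve_def vector_field_along_def S_def by blast+
  have "((\<lambda>s. metric_in M c (snd c (\<alpha> s)) (Y s c) (Z s c)) has_real_derivative
     metric_in M c (snd c (\<alpha> t)) (cov_deriv M \<alpha> Y t c) (Z t c)
     + metric_in M c (snd c (\<alpha> t)) (Y t c) (cov_deriv M \<alpha> Z t c)) (at t)"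
    using metric_in_has_derivative[OF M cA imageI[OF tc] deriv[OF sm(1)]
        deriv[OF sm(2)] deriv[OF sm(3)]] c
    by (simp add: cov_deriv_def christoffel_term_def velocity_def)
  moreover have "metric_in M c (snd c (\<alpha> s)) (Y s c) (Z s c) = riem_inner M (\<alpha> s) (Y s) (Z s)"
    if "s \<in> S" for s
    using that cA Y Z unfolding S_def vector_field_along_def
    by (intro riem_inner_eq[OF M, symmetric]) (auto simp: charts_at_def)
  ultimately show ?thesis
    by (rule has_field_derivative_transform_within_open[OF _ openS tS])
qed

text \<open>The form in which the Frenet equations are used: a linear relation for \<open>\<nabla> Y\<close> becomes a relation
  between inner products with \<open>X\<close>, because \<open>\<nabla> X = 0\<close> removes the other term of the product rule.\<close>

lemma inner_parallel_has_derivative: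
  assumes M: "riemannian_manifold M" and I: "open I" and \<alpha>: "smooth_curve M I \<alpha>"
    and Y: "vector_field_along M I \<alpha> Y" and X: "LC_parallel M I \<alpha> X"
    and t: "t \<in> I" and speed: "speed M \<alpha> t > 0"
    and P: "P \<in> tangent_space M (\<alpha> t)" and Q: "Q \<in> tangent_space M (\<alpha> t)"
    and nabla: "nabla_v1 M \<alpha> Y t = (\<lambda>c. a *\<^sub>R P c + b *\<^sub>R Q c)"
  shows "((\<lambda>s. riem_inner M (\<alpha> s) (Y s) (X s)) has_real_derivative
     speed M \<alpha> t * (a * riem_inner M (\<alpha> t) P (X t) + b * riem_inner M (\<alpha> t) Q (X t))) (at t)"
proof -
  have Xf: "vector_field_along M I \<alpha> X" and Xt: "X t \<in> tangent_space M (\<alpha> t)"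
    using X t unfolding LC_parallel_def vector_field_along_def by blast+
  have "\<alpha> t \<in> topspace (mtop M)"
    using \<alpha> t unfolding smooth_curve_def continuous_map_def by auto
  then obtain c where c: "c \<in> charts_at M (\<alpha> t)"
    using M unfolding riemannian_manifold_def smooth_manifold_def charts_at_def by auto
  have "cov_deriv M \<alpha> Y t c = speed M \<alpha> t *\<^sub>R nabla_v1 M \<alpha> Y t c"
    using speed by (simp add: nabla_v1_def)
  then have DY: "cov_deriv M \<alpha> Y t c = speed M \<alpha> t *\<^sub>R (a *\<^sub>R P c + b *\<^sub>R Q c)"
    by (simp add: nabla)
  have "nabla_v1 M \<alpha> X t c = 0" using X t unfolding LC_parallel_def by simp
  then have "cov_deriv M \<alpha> X t c = 0 *\<^sub>R X t c" using speed by (simp add: nabla_v1_def)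
  then show ?thesis
    using riem_inner_has_derivative[OF M I \<alpha> Y Xf t c]
    by (simp only: DY metric_in_bilinear riem_inner_eq[OF M c P Xt] riem_inner_eq[OF M c Q Xt]
        mult_zero_left add_0_right)
qed

section \<open>Solving the Frenet system of a helix\<close>

text \<open>Differentiability of \<open>h\<close> is deduced from that of \<open>f = h * c\<close>. For \<open>c = 0\<close> nothing is known about
  \<open>h\<close>, but then both sides vanish, whatever value \<open>deriv h t\<close> has.\<close>

lemma arclength_deriv_constant_multiple:
  assumes S: "open S" "t \<in> S" and eq: "\<And>s. s \<in> S \<Longrightarrow> f s = h s * c"
    and f: "(f has_real_derivative speed M \<alpha> t * d) (at t)" and speed: "speed M \<alpha> t > 0"
  shows "d = arclength_deriv M \<alpha> h t * c"
proof (cases "c = 0")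
  case True
  have "((\<lambda>_. 0) has_real_derivative speed M \<alpha> t * d) (at t)"
    by (rule has_field_derivative_transform_within_open[OF f S]) (simp add: eq True)
  then have "speed M \<alpha> t * d = 0" using DERIV_unique DERIV_const by blast
  then show ?thesis using speed True by simp
next
  case False
  have "((\<lambda>s. f s / c) has_real_derivative speed M \<alpha> t * d / c) (at t)"
    using f by (rule DERIV_cdivide)
  then have "(h has_real_derivative speed M \<alpha> t * d / c) (at t)"
    by (rule has_field_derivative_transform_within_open[OF _ S]) (simp add: eq False)
  then have "deriv h t = speed M \<alpha> t * d / c" by (rule DERIV_imp_deriv)
  then show ?thesis using speed False by (simp add: arclength_deriv_def)
qed

theorem theorem1:
  fixes M :: "('m, 'n::finite) manifold"
    and \<kappa> :: real
    and I :: "real set"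
    and \<alpha> :: "real \<Rightarrow> 'm"
    and v :: "nat \<Rightarrow> real \<Rightarrow> ('m, 'n) tangent"
    and k :: "nat \<Rightarrow> real \<Rightarrow> real"
    and X :: "real \<Rightarrow> ('m, 'n) tangent"
  assumes "CARD('n) \<ge> 3"
    and "space_form M \<kappa> \<or> euclidean_hypersurface M"
    and "open I" and "is_interval I" and "I \<noteq> {}"
    and "nondegenerate_curve M I \<alpha> v k"
    and "LC_helix_with_axis M I \<alpha> v X"
  shows "\<forall>i. 1 < i \<and> i \<le> CARD('n) - 2 \<longrightarrow>
    (\<forall>t\<in>I. riem_inner M (\<alpha> t) (v (i + 2) t) (X t) =
      harmonic_curvature M \<alpha> k i t * riem_inner M (\<alpha> t) (v 1 t) (X t))"
proof -
  define f where "f i t = riem_inner M (\<alpha> t) (v i t) (X t)" for i t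
  define H where "H = harmonic_curvature M \<alpha> k"
  note n = assms(1) and I = assms(3)
  have M: "riemannian_manifold M"
    using assms(2) unfolding space_form_def euclidean_hypersurface_def by blast
  have \<alpha>: "smooth_curve M I \<alpha>"
    and v: "\<And>i. 1 \<le> i \<Longrightarrow> i \<le> CARD('n) \<Longrightarrow> vector_field_along M I \<alpha> (v i)"
    and speed: "\<And>t. t \<in> I \<Longrightarrow> speed M \<alpha> t > 0"
    and k: "\<And>i t. t \<in> I \<Longrightarrow> 1 \<le> i \<Longrightarrow> i < CARD('n) \<Longrightarrow> k i t \<noteq> 0"
    and frenet1: "\<And>t. t \<in> I \<Longrightarrow> nabla_v1 M \<alpha> (v 1) t = (\<lambda>c. k 1 t *\<^sub>R v 2 t c)"
    and frenet: "\<And>i t. t \<in> I \<Longrightarrow> 1 < i \<Longrightarrow> i < CARD('n) \<Longrightarrow> nabla_v1 M \<alpha> (v i) t =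
        (\<lambda>c. - k (i - 1) t *\<^sub>R v (i - 1) t c + k i t *\<^sub>R v (i + 1) t c)"
    using assms(6) unfolding nondegenerate_curve_def by auto
  have X: "LC_parallel M I \<alpha> X"
    using assms(7) unfolding LC_helix_with_axis_def by blast
  obtain \<phi> where f1: "\<And>t. t \<in> I \<Longrightarrow> f 1 t = 1 * cos \<phi>"
    using assms(7) unfolding LC_helix_with_axis_def f_def by auto
  have vt: "v i t \<in> tangent_space M (\<alpha> t)" if "t \<in> I" "1 \<le> i" "i \<le> CARD('n)" for i t
    using v that unfolding vector_field_along_def by blast
  \<comment> \<open>\<open>\<nabla> (v 1)\<close> has a single component; the second one is padded with coefficient \<open>0\<close>.\<close>
  have df1: "(f 1 has_real_derivative speed M \<alpha> t * (k 1 t * f 2 t)) (at t)" if t: "t \<in> I" for t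
    using inner_parallel_has_derivative[OF M I \<alpha> v X t speed[OF t] vt[OF t, of 2] vt[OF t, of 2],
        of 1 "k 1 t" 0] frenet1[OF t] n
    by (simp add: f_def[abs_def])
  have df: "(f i has_real_derivative
      speed M \<alpha> t * (- k (i - 1) t * f (i - 1) t + k i t * f (i + 1) t)) (at t)"
    if t: "t \<in> I" and i: "1 < i" "i < CARD('n)" for i t
    using inner_parallel_has_derivative[OF M I \<alpha> v[of i] X t speed[OF t]
        vt[OF t, of "i - 1"] vt[OF t, of "i + 1"]
        frenet[OF t i]] i
    by (simp add: f_def[abs_def])
  \<comment> \<open>\<open>f 1\<close> is regarded as the multiple \<open>1 * cos \<phi>\<close> of a constant function.\<close>
  have f2: "f 2 t = 0" if t: "t \<in> I" for t
  proof -
    have "k 1 t * f 2 t = arclength_deriv M \<alpha> (\<lambda>_. 1) t * cos \<phi>"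
      by (rule arclength_deriv_constant_multiple[OF I t f1 df1[OF t] speed[OF t]])
    then show ?thesis using k[OF t, of 1] n by (simp add: arclength_deriv_def)
  qed
  \<comment> \<open>The recursion of the harmonic curvatures has depth two, so two consecutive values are carried
    along. The index starts at \<open>j = 0\<close>, where \<open>f 2 = 0\<close> matches \<open>H 0 = 0\<close>; the bound on \<open>j + 3\<close> is
    where the frame ends.\<close>
  have step: "f (j + 2) t = H j t * cos \<phi> \<and> (j + 3 \<le> CARD('n) \<longrightarrow> f (j + 3) t = H (j + 1) t * cos \<phi>)"
    if "j + 2 \<le> CARD('n)" "t \<in> I" for j t
    using that
  proof (induction j arbitrary: t)
    case 0
    \<comment> \<open>The equation for the derivative of \<open>f 2 = 0\<close>.\<close>
    have "- k 1 t * cos \<phi> + k 2 t * f 3 t = arclength_deriv M \<alpha> (\<lambda>_. 0) t * cos \<phi>"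
      using n f2 f1[OF 0(2)] arclength_deriv_constant_multiple[where f = "f 2", OF I 0(2) _
          df[OF 0(2), of 2] speed[OF 0(2)], of "\<lambda>_. 0" "cos \<phi>"]
      by (simp add: numeral_3_eq_3)
    then show ?case
      using f2[OF 0(2)] k[OF 0(2), of 2] n
      by (simp add: H_def arclength_deriv_def field_simps numeral_2_eq_2[symmetric])
  next
    case (Suc j)
    have eq: "f (j + 3) s = H (j + 1) s * cos \<phi>" if "s \<in> I" for s
      using Suc.IH[of s] Suc.prems that by simp
    have "f (j + 4) t = H (j + 2) t * cos \<phi>" if j: "j + 4 \<le> CARD('n)"
    proof -
      have "- k (j + 2) t * f (j + 2) t + k (j + 3) t * f (j + 4) t
          = arclength_deriv M \<alpha> (H (j + 1)) t * cos \<phi>"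
        using j arclength_deriv_constant_multiple[OF I Suc.prems(2) eq
            df[OF Suc.prems(2), of "j + 3"] speed[OF Suc.prems(2)]]
        by (simp add: add.commute)
      moreover have "f (j + 2) t = H j t * cos \<phi>" using Suc.IH[of t] Suc.prems by simp
      ultimately show ?thesis
        using k[OF Suc.prems(2), of "j + 3"] j by (simp add: H_def field_simps)
    qed
    then show ?case using eq[OF Suc.prems(2)] by (simp add: eval_nat_numeral)
  qed
  show ?thesis
    using step f1 n unfolding f_def H_def by fastforce
qed

end
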